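(* Let $L$ be a slim planar semimodular lattice and $D:=\operatorname{Con} L$. If $x\in J(D)$, $y\in\operatorname{Max}(J(D))$ and $x\prec_{J(D)} y$, then there exists an element $z\in J(D)$ such that $z\neq y$ and $x\prec_{J(D)} z$.
   Context: Planar lattices are finite by definition (finite lattices with a planar Hasse diagram). A planar (upper) semimodular lattice is slim if the five-element nondistributive modular lattice $M_3$ is not a sublattice of it. $\operatorname{Con}L$ is the congruence lattice of $L$. For a finite distributive lattice $D$, $J(D)$ is the poset of nonzero join-irreducible elements with the order inherited from $D$, $\prec_{J(D)}$ is the covering relation of this poset, and $\operatorname{Max}(J(D))$ is the set of its maximal elements. *)

theory Defs
  imports "HOL-Analysis.Analysis"
begin

definition covers_in :: "'b::order set \<Rightarrow> 'b \<Rightarrow> 'b \<Rightarrow> bool" where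
  "covers_in P x y \<longleftrightarrow> x \<in> P \<and> y \<in> P \<and> x < y \<and> \<not> (\<exists>z\<in>P. x < z \<and> z < y)"

definition maximal_elements :: "'b::order set \<Rightarrow> 'b set" where
  "maximal_elements P = {x \<in> P. \<not> (\<exists>y\<in>P. x < y)}"

(* The carrier D need not be closed under the operations of the ambient type, so joins
   and the zero are those of the ordered set D itself. *)

definition is_join_in :: "'b::order set \<Rightarrow> 'b \<Rightarrow> 'b \<Rightarrow> 'b \<Rightarrow> bool" where
  "is_join_in D a b x \<longleftrightarrow>
     x \<in> D \<and> a \<le> x \<and> b \<le> x \<and> (\<forall>u\<in>D. a \<le> u \<and> b \<le> u \<longrightarrow> x \<le> u)"

definition is_zero_in :: "'b::order set \<Rightarrow> 'b \<Rightarrow> bool" where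
  "is_zero_in D x \<longleftrightarrow> x \<in> D \<and> (\<forall>u\<in>D. x \<le> u)"

definition join_irreducibles :: "'b::order set \<Rightarrow> 'b set" where
  "join_irreducibles D =
     {x \<in> D. \<not> is_zero_in D x \<and>
             (\<forall>a\<in>D. \<forall>b\<in>D. is_join_in D a b x \<longrightarrow> x = a \<or> x = b)}"

(* Congruences are sets of pairs, so the order of the congruence lattice is inclusion. *)

definition Con :: "('a::lattice \<times> 'a) set set" where
  "Con = {\<theta>. equiv UNIV \<theta> \<and>
            (\<forall>a b c d. (a, b) \<in> \<theta> \<and> (c, d) \<in> \<theta> \<longrightarrow>
               (sup a c, sup b d) \<in> \<theta> \<and> (inf a c, inf b d) \<in> \<theta>)}"

definition semimodular :: "'a::lattice itself \<Rightarrow> bool" where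
  "semimodular _ \<longleftrightarrow>
     (\<forall>a b c :: 'a. covers_in UNIV a b \<longrightarrow>
        sup a c = sup b c \<or> covers_in UNIV (sup a c) (sup b c))"

definition slim :: "'a::lattice itself \<Rightarrow> bool" where
  "slim _ \<longleftrightarrow>
     \<not> (\<exists>z a b c u :: 'a. distinct [z, a, b, c, u] \<and>
          inf a b = z \<and> inf a c = z \<and> inf b c = z \<and>
          sup a b = u \<and> sup a c = u \<and> sup b c = u)"

(* A Hasse diagram places the elements at distinct points of the plane and draws each
   covering pair as a straight segment, ascending in the second coordinate, that passes
   through no other element. *)

definition hasse_diagram :: "('a::order \<Rightarrow> real \<times> real) \<Rightarrow> bool" where
  "hasse_diagram p \<longleftrightarrow> inj p \<and>
     (\<forall>a b. covers_in UNIV a b \<longrightarrow>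
        snd (p a) < snd (p b) \<and>
        (\<forall>c. p c \<in> closed_segment (p a) (p b) \<longrightarrow> c = a \<or> c = b))"

definition planar_diagram :: "('a::order \<Rightarrow> real \<times> real) \<Rightarrow> bool" where
  "planar_diagram p \<longleftrightarrow> hasse_diagram p \<and>
     (\<forall>a b c d. covers_in UNIV a b \<and> covers_in UNIV c d \<and> (a, b) \<noteq> (c, d) \<longrightarrow>
        closed_segment (p a) (p b) \<inter> closed_segment (p c) (p d) \<subseteq> p ` ({a, b} \<inter> {c, d}))"

definition planar :: "'a::{finite,lattice} itself \<Rightarrow> bool" where
  "planar _ \<longleftrightarrow> (\<exists>p :: 'a \<Rightarrow> real \<times> real. planar_diagram p)"

end

theory Submission
  imports Defs
begin

text \<open>A slim planar semimodular lattice is generated by its leftmost and its rightmost maximal chain: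
  every element is a join \<open>sup c d\<close> with \<open>c\<close> and \<open>d\<close> on these chains. The nonzero join-irreducible
  congruences are the ones that collapse a meet-irreducible \<open>m\<close> with its unique cover. If \<open>m\<close> is
  meet-prime, this congruence is maximal among them and determines \<open>m\<close>. Otherwise, in a finite
  lattice generated by two maximal chains, it lies below the congruences of two different meet-prime
  elements, one for each chain. So a join-irreducible congruence that is not maximal lies below at
  least two maximal ones, and a cover of \<open>x\<close> below a maximal element other than \<open>y\<close> is not \<open>y\<close>.\<close>

section \<open>Congruences and unique upper covers\<close>

text \<open>Changing one argument at a time and composing by transitivity gives two-sided
  compatibility, so only one-sided translations have to be checked.\<close>

lemma Con_iff:
  "\<theta> \<in> Con \<longleftrightarrow> (\<forall>a. (a, a) \<in> \<theta>) \<and> sym \<theta> \<and> trans \<theta> \<and>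
    (\<forall>a b c. (a, b) \<in> \<theta> \<longrightarrow> (sup a c, sup b c) \<in> \<theta> \<and> (inf a c, inf b c) \<in> \<theta>)"
    (is "_ \<longleftrightarrow> ?R")
proof
  assume "\<theta> \<in> Con"
  then show ?R
    by (auto simp: Con_def equiv_def refl_on_def)
next
  assume R: ?R
  have "(sup a c, sup b d) \<in> \<theta> \<and> (inf a c, inf b d) \<in> \<theta>"
    if "(a, b) \<in> \<theta>" "(c, d) \<in> \<theta>" for a b c d
  proof -
    have "(sup a c, sup b c) \<in> \<theta>" "(inf a c, inf b c) \<in> \<theta>"
      using R that by auto
    moreover have "(sup b c, sup b d) \<in> \<theta>" "(inf b c, inf b d) \<in> \<theta>"
      using R that by (metis sup_commute, metis inf_commute)
    ultimately show ?thesis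
      using R by (meson transD)
  qed
  then show "\<theta> \<in> Con"
    using R by (auto simp: Con_def equiv_def refl_on_def)
qed

lemma
  assumes "\<theta> \<in> Con"
  shows Con_refl: "(a, a) \<in> \<theta>"
    and Con_sym: "(a, b) \<in> \<theta> \<Longrightarrow> (b, a) \<in> \<theta>"
    and Con_trans: "(a, b) \<in> \<theta> \<Longrightarrow> (b, c) \<in> \<theta> \<Longrightarrow> (a, c) \<in> \<theta>"
    and Con_sup: "(a, b) \<in> \<theta> \<Longrightarrow> (sup a c, sup b c) \<in> \<theta>"
    and Con_inf: "(a, b) \<in> \<theta> \<Longrightarrow> (inf a c, inf b c) \<in> \<theta>"
  using assms unfolding Con_iff by (auto dest: symD transD)

lemma Con_convex:
  assumes "\<theta> \<in> Con" "(a, c) \<in> \<theta>" "a \<le> b" "b \<le> c"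
  shows "(a, b) \<in> \<theta>"
  using Con_inf[OF assms(1,2), of b] assms(3,4) by (simp add: inf.absorb1 inf.absorb2)

lemma Con_Inter: "S \<subseteq> Con \<Longrightarrow> \<Inter>S \<in> Con"
  unfolding Con_iff[of "\<Inter>S"]
  by (intro conjI allI impI symI transI InterI; drule (1) subsetD)
    (auto intro: Con_refl Con_sym Con_trans Con_sup Con_inf)

lemma Id_in_Con: "Id \<in> Con"
  unfolding Con_iff by (auto intro: symI transI)

definition cg :: "'a::lattice \<Rightarrow> 'a \<Rightarrow> ('a \<times> 'a) set" where
  "cg a b = \<Inter>{\<theta> \<in> Con. (a, b) \<in> \<theta>}"

lemma cg_in_Con: "cg a b \<in> Con"
  unfolding cg_def by (rule Con_Inter) auto

lemma in_cg: "(a, b) \<in> cg a b"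
  unfolding cg_def by auto

lemma cg_le_iff: "\<theta> \<in> Con \<Longrightarrow> cg a b \<subseteq> \<theta> \<longleftrightarrow> (a, b) \<in> \<theta>"
  using in_cg[of a b] unfolding cg_def by auto

text \<open>In a finite lattice the elements \<open>m\<close> with such an \<open>n\<close> are the
  meet-irreducible ones other than the top.\<close>

definition unique_cover :: "'a::order \<Rightarrow> 'a \<Rightarrow> bool" where
  "unique_cover m n \<longleftrightarrow> m < n \<and> (\<forall>y. m < y \<longrightarrow> n \<le> y)"

text \<open>Joining with \<open>m\<close> moves \<open>a\<close> to \<open>m\<close> and
  \<open>b\<close> strictly above \<open>m\<close>, hence to at least \<open>n\<close>; convexity
  does the rest.\<close>

lemma Con_unique_cover_of_not_le:
  assumes "\<theta> \<in> Con" "unique_cover m n" "(a, b) \<in> \<theta>" "a \<le> m" "\<not> b \<le> m"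
  shows "(m, n) \<in> \<theta>"
proof (rule Con_convex[OF assms(1)])
  have "(sup a m, sup b m) \<in> \<theta>"
    using Con_sup assms by blast
  then show "(m, sup b m) \<in> \<theta>"
    using assms(4) by (simp add: sup.absorb2)
  show "m \<le> n" using assms(2) by (auto simp: unique_cover_def)
  have "m < sup b m"
    using assms(5) by (metis sup.absorb_iff2 sup.strict_order_iff sup_commute sup_ge2)
  then show "n \<le> sup b m"
    using assms(2) by (auto simp: unique_cover_def)
qed

text \<open>For a collapsed pair \<open>a \<le> b\<close>, some collapsed unique cover links
  \<open>b\<close> to a smaller element above \<open>a\<close>; induct on the size of the ideal of
  \<open>b\<close>. Thus a congruence is determined by the unique covers that it collapses.\<close>

lemma Con_subset_if_unique_covers:
  fixes \<theta> \<psi> :: "('a::{finite,lattice} \<times> 'a) set"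
  assumes \<theta>: "\<theta> \<in> Con" and \<psi>: "\<psi> \<in> Con"
    and sub: "\<And>m n. unique_cover m n \<Longrightarrow> (m, n) \<in> \<theta> \<Longrightarrow> (m, n) \<in> \<psi>"
  shows "\<theta> \<subseteq> \<psi>"
proof -
  have le: "a \<le> b \<Longrightarrow> (a, b) \<in> \<theta> \<Longrightarrow> (a, b) \<in> \<psi>" for a b
  proof (induction "card {..b}" arbitrary: b rule: less_induct)
    case less
    show ?case
    proof (cases "a = b")
      case True
      then show ?thesis using Con_refl[OF \<psi>] by simp
    next
      case False
      then have "a \<in> {x. a \<le> x \<and> \<not> b \<le> x}"
        using less.prems by auto
      \<comment> \<open>By maximality everything strictly above \<open>m\<close> is above
        \<open>b\<close>, so \<open>sup m b\<close> is its unique cover.\<close>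
      then obtain m where m: "a \<le> m" "\<not> b \<le> m" "\<And>x. m < x \<Longrightarrow> b \<le> x"
        using finite_has_maximal2[of "{x. a \<le> x \<and> \<not> b \<le> x}" a]
        by (auto simp: less_le_not_le) (metis order.trans)
      have "m < sup m b"
        using m(2) by (metis sup.cobounded1 sup.cobounded2 order.not_eq_order_implies_strict)
      then have u: "unique_cover m (sup m b)"
        using m(3) by (auto simp: unique_cover_def less_imp_le)
      have "(m, sup m b) \<in> \<psi>"
        using sub[OF u] Con_unique_cover_of_not_le[OF \<theta> u less.prems(2) m(1,2)] .
      \<comment> \<open>Meeting with \<open>b\<close> transports the collapsed cover of
        \<open>m\<close> to a pair with upper end \<open>b\<close>.\<close>
      then have top: "(inf m b, b) \<in> \<psi>"
        using Con_inf[OF \<psi>, of m "sup m b" b] by (simp add: inf.absorb2)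
      have ab: "a \<le> inf m b" "inf m b \<le> b" "inf m b \<noteq> b"
        using m less.prems(1) by (auto dest: inf.absorb_iff2[THEN iffD2])
      then have "{..inf m b} \<subset> {..b}"
        by (metis atMost_iff atMost_subset_iff order_antisym order_refl psubsetI)
      then have "card {..inf m b} < card {..b}"
        by (rule psubset_card_mono[rotated]) auto
      then have "(a, inf m b) \<in> \<psi>"
        using less.hyps ab Con_convex[OF \<theta> less.prems(2) ab(1,2)] by blast
      then show ?thesis
        using top Con_trans[OF \<psi>] by blast
    qed
  qed
  show ?thesis
  proof (rule subrelI)
    fix a b assume ab: "(a, b) \<in> \<theta>"
    have "(inf a b, a) \<in> \<theta>"
      using Con_inf[OF \<theta> Con_sym[OF \<theta> ab], of a] by (simp add: inf_commute)
    moreover have "(inf a b, b) \<in> \<theta>"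
      using Con_inf[OF \<theta> ab, of b] by simp
    ultimately have "(inf a b, a) \<in> \<psi>" "(inf a b, b) \<in> \<psi>"
      by (auto intro: le)
    then show "(a, b) \<in> \<psi>"
      using Con_sym[OF \<psi>] Con_trans[OF \<psi>] by blast
  qed
qed

text \<open>Take \<psi> maximal among the congruences properly below \<open>x\<close>. A unique
  cover collapsed by \<open>x\<close> but not by \<psi> generates a congruence whose join with
  \<psi> is \<open>x\<close>, so irreducibility makes it equal to \<open>x\<close>.\<close>

lemma join_irreducible_Con_is_cg:
  fixes x :: "('a::{finite,lattice} \<times> 'a) set"
  assumes x: "x \<in> join_irreducibles Con"
  obtains m n where "unique_cover m n" "x = cg m n"
proof -
  have xC: "x \<in> Con" and nz: "\<not> is_zero_in Con x"
    and irr: "\<And>a b. a \<in> Con \<Longrightarrow> b \<in> Con \<Longrightarrow> is_join_in Con a b x \<Longrightarrow> x = a \<or> x = b"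
    using x by (auto simp: join_irreducibles_def)
  have Id_le: "Id \<subseteq> u" if "u \<in> Con" for u
    using Con_refl[OF that] by auto
  then have "x \<noteq> Id"
    using nz Id_in_Con by (auto simp: is_zero_in_def)
  then have "Id \<in> {\<psi> \<in> Con. \<psi> \<subset> x}"
    using Id_le[OF xC] Id_in_Con by auto
  from finite_has_maximal2[OF finite this] obtain \<psi> where "\<psi> \<in> {\<psi> \<in> Con. \<psi> \<subset> x}"
    and "\<forall>\<phi>\<in>{\<psi> \<in> Con. \<psi> \<subset> x}. \<psi> \<subseteq> \<phi> \<longrightarrow> \<psi> = \<phi>"
    by blast
  then have \<psi>: "\<psi> \<in> Con" "\<psi> \<subset> x"
    and max: "\<And>\<phi>. \<phi> \<in> Con \<Longrightarrow> \<psi> \<subseteq> \<phi> \<Longrightarrow> \<phi> \<subset> x \<Longrightarrow> \<psi> = \<phi>"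
    by simp_all
  obtain m n where mn: "unique_cover m n" "(m, n) \<in> x" "(m, n) \<notin> \<psi>"
    using Con_subset_if_unique_covers[OF xC \<psi>(1)] \<psi>(2) by blast
  have "is_join_in Con \<psi> (cg m n) x"
    unfolding is_join_in_def
  proof (intro conjI ballI impI)
    show "x \<in> Con" "\<psi> \<subseteq> x" using xC \<psi> by auto
    show "cg m n \<subseteq> x" using cg_le_iff[OF xC] mn by blast
    fix u assume u: "u \<in> Con" "\<psi> \<subseteq> u \<and> cg m n \<subseteq> u"
    \<comment> \<open>Cutting \<open>u\<close> down to \<open>x\<close> gives a congruence strictly
      above \<psi>, which maximality forces to be \<open>x\<close>.\<close>
    have "u \<inter> x \<in> Con"
      using u(1) xC Con_Inter[of "{u, x}"] by simp
    moreover have "\<psi> \<subseteq> u \<inter> x" "\<psi> \<noteq> u \<inter> x"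
      using u \<psi> mn in_cg[of m n] by auto
    ultimately have "\<not> u \<inter> x \<subset> x"
      using max[of "u \<inter> x"] by blast
    then show "x \<subseteq> u"
      by blast
  qed
  then have "x = cg m n"
    using irr[OF \<psi>(1) cg_in_Con] \<psi>(2) by blast
  then show thesis using that mn(1) by blast
qed

text \<open>Translations map chains of steps to chains of steps. The closure is the join of the two
  congruences.\<close>

lemma Con_rtrancl_Un:
  assumes \<alpha>: "\<alpha> \<in> Con" and \<beta>: "\<beta> \<in> Con"
  shows "(\<alpha> \<union> \<beta>)\<^sup>* \<in> Con"
proof -
  have "(sup a c, sup b c) \<in> (\<alpha> \<union> \<beta>)\<^sup>* \<and> (inf a c, inf b c) \<in> (\<alpha> \<union> \<beta>)\<^sup>*"
    if "(a, b) \<in> (\<alpha> \<union> \<beta>)\<^sup>*" for a b c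
    using that
  proof induction
    case (step y z)
    then have "(sup y c, sup z c) \<in> \<alpha> \<union> \<beta>" "(inf y c, inf z c) \<in> \<alpha> \<union> \<beta>"
      using Con_sup[OF \<alpha>] Con_sup[OF \<beta>] Con_inf[OF \<alpha>] Con_inf[OF \<beta>] by blast+
    then show ?case using step.IH by (meson rtrancl.rtrancl_into_rtrancl)
  qed auto
  moreover have "sym (\<alpha> \<union> \<beta>)"
    using Con_sym[OF \<alpha>] Con_sym[OF \<beta>] by (auto intro: symI)
  ultimately show ?thesis
    unfolding Con_iff by (auto intro: sym_rtrancl trans_rtrancl)
qed

text \<open>A chain of \<open>\<alpha>\<close>- and \<open>\<beta>\<close>-steps from \<open>m\<close> to \<open>n\<close> contains a step that leaves the ideal below
  \<open>m\<close>, and the congruence of this step collapses \<open>m\<close> and \<open>n\<close>.\<close>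

lemma cg_unique_cover_join_irreducible:
  assumes u: "unique_cover m n"
  shows "cg m n \<in> join_irreducibles Con"
proof -
  have mn: "m < n" using u by (simp add: unique_cover_def)
  have "(m, n) \<in> cg m n" "(m, n) \<notin> Id" using mn in_cg[of m n] by auto
  then have nz: "\<not> is_zero_in Con (cg m n)"
    using Id_in_Con unfolding is_zero_in_def by blast
  have prime: "(m, n) \<in> \<alpha> \<or> (m, n) \<in> \<beta>"
    if \<alpha>: "\<alpha> \<in> Con" and \<beta>: "\<beta> \<in> Con" and mem: "(m, n) \<in> (\<alpha> \<union> \<beta>)\<^sup>*" for \<alpha> \<beta>
  proof (rule ccontr)
    assume neg: "\<not> ?thesis"
    have "z \<le> m" if "(m, z) \<in> (\<alpha> \<union> \<beta>)\<^sup>*" for z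
      using that
    proof induction
      case (step y z)
      then show ?case
        using Con_unique_cover_of_not_le[OF _ u, of _ y z] \<alpha> \<beta> neg by blast
    qed auto
    from this[OF mem] show False using mn by auto
  qed
  have "cg m n = a \<or> cg m n = b"
    if a: "a \<in> Con" and b: "b \<in> Con" and j: "is_join_in Con a b (cg m n)" for a b
  proof -
    have "cg m n \<subseteq> (a \<union> b)\<^sup>*"
      using j Con_rtrancl_Un[OF a b] by (auto simp: is_join_in_def)
    then have "(m, n) \<in> a \<or> (m, n) \<in> b"
      using prime[OF a b] in_cg[of m n] by blast
    then have "cg m n \<subseteq> a \<or> cg m n \<subseteq> b"
      using cg_le_iff[OF a] cg_le_iff[OF b] by blast
    moreover have "a \<subseteq> cg m n" "b \<subseteq> cg m n"
      using j unfolding is_join_in_def by blast+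
    ultimately show ?thesis by blast
  qed
  then show ?thesis
    using nz cg_in_Con by (auto simp: join_irreducibles_def)
qed

text \<open>The top satisfies this trivially; pairing it with \<open>unique_cover\<close> leaves the
  proper case.\<close>

definition meet_prime :: "'a::lattice \<Rightarrow> bool" where
  "meet_prime m \<longleftrightarrow> (\<forall>a b. inf a b \<le> m \<longrightarrow> a \<le> m \<or> b \<le> m)"

text \<open>A meet-prime \<open>m\<close> yields the congruence whose two classes are the ideal below \<open>m\<close> and
  its complement; the only unique cover that it separates is the one of \<open>m\<close>.\<close>

lemma meet_prime_cg_le_imp_eq:
  assumes m: "unique_cover m m'" and n: "unique_cover n n'" and prime: "meet_prime m"
    and le: "cg m m' \<subseteq> cg n n'"
  shows "n = m"
proof -
  define \<theta> where "\<theta> = {(a, b). a \<le> m \<longleftrightarrow> b \<le> m}"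
  have "inf a c \<le> m \<longleftrightarrow> a \<le> m \<or> c \<le> m" for a c
    using prime unfolding meet_prime_def by (meson inf.coboundedI1 inf.coboundedI2)
  then have \<theta>: "\<theta> \<in> Con"
    unfolding Con_iff \<theta>_def by (auto intro!: symI transI)
  have "(m, m') \<notin> \<theta>"
    using m by (auto simp: \<theta>_def unique_cover_def)
  then have "(n, n') \<notin> \<theta>"
    using le cg_le_iff[OF \<theta>] by blast
  then have "n \<le> m" "\<not> n' \<le> m"
    using n by (auto simp: \<theta>_def unique_cover_def)
  \<comment> \<open>If \<open>n < m\<close>, then \<open>n' \<le> m\<close> because
    \<open>n'\<close> lies below everything strictly above \<open>n\<close>.\<close>
  then show ?thesis
    using n unfolding unique_cover_def by (metis order.order_iff_strict)
qed

section \<open>Lattices generated by two maximal chains\<close>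

text \<open>In a finite lattice these are the maximal chains, described by climbing from the bottom
  through covers.\<close>

definition full_chain :: "'a::order set \<Rightarrow> bool" where
  "full_chain C \<longleftrightarrow> (\<exists>b\<in>C. \<forall>x. b \<le> x) \<and> (\<forall>a\<in>C. \<forall>b\<in>C. a \<le> b \<or> b \<le> a) \<and>
     (\<forall>a\<in>C. (\<exists>x. a < x) \<longrightarrow> (\<exists>b\<in>C. covers_in UNIV a b))"

text \<open>The largest member of the chain satisfying the down-closed \<open>P\<close> is not the
  top, since \<open>P\<close> fails at \<open>y\<close>; its cover in the chain is the first
  failure.\<close>

lemma full_chain_cut:
  fixes C :: "'a::{finite,lattice} set"
  assumes C: "full_chain C" and "P x" and "\<not> P y"
    and anti: "\<And>a b. a \<le> b \<Longrightarrow> P b \<Longrightarrow> P a"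
  obtains c c' where "c \<in> C" "c' \<in> C" "covers_in UNIV c c'" "P c" "\<not> P c'"
    "\<And>e. e \<in> C \<Longrightarrow> e \<le> c \<or> c' \<le> e"
proof -
  obtain b where "b \<in> C" "b \<le> x"
    using C by (auto simp: full_chain_def)
  then have "b \<in> {c \<in> C. P c}"
    using anti[of b x] \<open>P x\<close> by auto
  then obtain c where c: "c \<in> C" "P c" and max: "\<And>e. e \<in> C \<Longrightarrow> P e \<Longrightarrow> c \<le> e \<Longrightarrow> e = c"
    using finite_has_maximal2[of "{c \<in> C. P c}" b] by auto
  have "c < sup c y"
    using anti[of y c] c \<open>\<not> P y\<close> by (metis sup.cobounded1 sup.cobounded2 order.not_eq_order_implies_strict)
  then obtain c' where c': "c' \<in> C" "covers_in UNIV c c'"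
    using C c by (auto simp: full_chain_def)
  then have nP: "\<not> P c'"
    using max[of c'] by (auto simp: covers_in_def less_le)
  have "e \<le> c \<or> c' \<le> e" if "e \<in> C" for e
    using C c c' that unfolding full_chain_def covers_in_def
    by (metis UNIV_I order.order_iff_strict)
  then show thesis
    using that c c' nP by blast
qed

text \<open>Witness: the greatest \<open>w\<close> that lies above the same elements of \<open>C\<close> as the largest element
  of \<open>C\<close> not above \<open>d1\<close>.\<close>

lemma meet_prime_above:
  fixes C K :: "'a::{finite,lattice} set"
  assumes C: "full_chain C" and K: "full_chain K"
    and gen: "\<And>a. \<exists>c\<in>C. \<exists>d\<in>K. a = sup c d"
    and c1: "c1 \<in> C" "c \<le> m" "\<not> c1 \<le> m" "\<And>e. e \<in> C \<Longrightarrow> e \<le> c \<or> c1 \<le> e"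
    and d1: "d1 \<in> K" "d \<le> m" "\<not> d1 \<le> m" "\<And>e. e \<in> K \<Longrightarrow> e \<le> d \<or> d1 \<le> e"
    and le: "inf c1 d1 \<le> m"
  obtains w w' where "unique_cover w w'" "meet_prime w" "c1 \<le> w" "\<not> d1 \<le> w"
    "inf w d1 \<le> m" "\<not> inf w' d1 \<le> m"
proof -
  \<comment> \<open>\<open>c1\<close> and \<open>d1\<close> are incomparable: otherwise
    \<open>inf c1 d1\<close> would be one of them, and neither lies below \<open>m\<close>.\<close>
  have dc: "\<not> d1 \<le> c1"
    using le d1(3) by (auto simp: inf.absorb2)
  have cd: "\<not> c1 \<le> d1"
    using le c1(3) by (auto simp: inf.absorb1)
  obtain g g' where g: "g \<in> C" "g' \<in> C" "covers_in UNIV g g'" "\<not> d1 \<le> g" "d1 \<le> g'"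
    and gcut: "\<And>e. e \<in> C \<Longrightarrow> e \<le> g \<or> g' \<le> e"
  proof (rule full_chain_cut[OF C, of "\<lambda>e. \<not> d1 \<le> e" c1 d1])
    show "\<And>a b. a \<le> b \<Longrightarrow> \<not> d1 \<le> b \<Longrightarrow> \<not> d1 \<le> a"
      by (meson order.trans)
  qed (use dc that in auto)
  have c1g: "c1 \<le> g"
    using gcut[OF c1(1)] g(5) dc by (auto dest: order.trans)
  have gg: "g < g'" "\<And>z. g < z \<Longrightarrow> z \<le> g' \<Longrightarrow> z = g'"
    using g(3) by (auto simp: covers_in_def order.order_iff_strict)
  have sup_d1: "sup g d1 = g'"
    using gg(2)[of "sup g d1"] gg(1) g(4,5)
    by (metis le_supI less_imp_le sup.cobounded1 sup.cobounded2 order.not_eq_order_implies_strict)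
  \<comment> \<open>\<open>h\<close> is the last element of \<open>K\<close> that can be joined to
    \<open>g\<close> without reaching \<open>g'\<close>.\<close>
  obtain h h' where h: "h \<in> K" "h' \<in> K" "\<not> g' \<le> sup g h" "g' \<le> sup g h'"
    and hcut: "\<And>e. e \<in> K \<Longrightarrow> e \<le> h \<or> h' \<le> e"
  proof (rule full_chain_cut[OF K, of "\<lambda>e. \<not> g' \<le> sup g e" g g'])
    show "\<not> g' \<le> sup g g" using gg(1) by auto
    show "\<not> \<not> g' \<le> sup g g'" by simp
    show "\<And>a b. a \<le> b \<Longrightarrow> \<not> g' \<le> sup g b \<Longrightarrow> \<not> g' \<le> sup g a"
      by (meson order.trans order_refl sup_mono)
  qed (use that in blast)
  define w where "w = sup g h"
  define w' where "w' = sup w g'"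
  have gw: "g \<le> w" and hw: "h \<le> w" and ng'w: "\<not> g' \<le> w"
    using h by (auto simp: w_def)
  \<comment> \<open>When \<open>y\<close> is split along the chains, its part in \<open>C\<close>
    stays below \<open>g\<close> and its part in \<open>K\<close> below \<open>h\<close>.\<close>
  have greatest: "y \<le> w" if "g \<le> y" "\<not> g' \<le> y" for y
  proof -
    obtain a b where ab: "a \<in> C" "b \<in> K" "y = sup a b" using gen by blast
    have "a \<le> g" using gcut[OF ab(1)] that ab(3) by (metis order.trans sup_ge1)
    moreover have "b \<le> h"
      using hcut[OF ab(2)] h(4) that ab(3) by (meson le_supI order.trans sup_ge2)
    ultimately show ?thesis unfolding ab(3) w_def by (rule sup_mono)
  qed
  have "w < w'"
    using ng'w by (metis w'_def order.not_eq_order_implies_strict sup_ge1 sup_ge2)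
  moreover have "w' \<le> y" if "w < y" for y
  proof -
    have "g' \<le> y"
      using greatest[of y] that gw by (meson leD less_imp_le order.trans)
    then show ?thesis using that by (simp add: w'_def)
  qed
  ultimately have uc: "unique_cover w w'"
    by (auto simp: unique_cover_def)
  have nd1w: "\<not> d1 \<le> w"
    using ng'w gw sup_d1 by (metis le_supI)
  have h'd1: "h' \<le> d1"
    using hcut[OF d1(1)] nd1w hw by (auto dest: order.trans)
  have nh'w: "\<not> h' \<le> w"
    using h(4) gw ng'w by (meson le_supI order.trans)
  \<comment> \<open>The complement of the ideal of \<open>w\<close> is the principal filter of
    \<open>h'\<close>, so \<open>w\<close> is meet-prime. The case \<open>g' \<le> a\<close> uses
    \<open>h' \<le> d1 \<le> g'\<close>.\<close>
  have above: "h' \<le> y" if "\<not> y \<le> w" for y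
  proof -
    obtain a b where ab: "a \<in> C" "b \<in> K" "y = sup a b" using gen by blast
    then consider "g' \<le> a" | "h' \<le> b" | "a \<le> g" "b \<le> h"
      using gcut hcut by blast
    then show ?thesis
    proof cases
      case 1
      then show ?thesis using ab(3) h'd1 g(5) by (meson order.trans sup_ge1)
    next
      case 2
      then show ?thesis using ab(3) by (meson order.trans sup_ge2)
    next
      case 3
      then have "y \<le> w" unfolding ab(3) w_def by (rule sup_mono)
      then show ?thesis using that by blast
    qed
  qed
  have "meet_prime w"
    unfolding meet_prime_def using above nh'w by (meson le_infI order.trans)
  \<comment> \<open>The part of \<open>inf w d1\<close> in \<open>C\<close> cannot reach
    \<open>c1\<close> and the part in \<open>K\<close> cannot reach \<open>d1\<close>, so they lie
    below \<open>c\<close> and \<open>d\<close>.\<close>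
  moreover have "inf w d1 \<le> m"
  proof -
    obtain a b where ab: "a \<in> C" "b \<in> K" "inf w d1 = sup a b" using gen by blast
    then have l: "a \<le> d1" "b \<le> w"
      by (metis inf.cobounded2 le_sup_iff, metis inf.cobounded1 le_sup_iff)
    have "a \<le> c" using c1(4)[OF ab(1)] l(1) cd by (auto dest: order.trans)
    moreover have "b \<le> d" using d1(4)[OF ab(2)] l(2) nd1w by (auto dest: order.trans)
    ultimately show ?thesis
      using ab(3) c1(2) d1(2) by (metis le_supI order.trans)
  qed
  moreover have "\<not> inf w' d1 \<le> m"
    using g(5) d1(3) by (simp add: w'_def inf.absorb2 le_supI2)
  ultimately show thesis
    using that uc nd1w c1g gw by (meson order.trans)
qed

text \<open>Meeting the pair \<open>w\<close>, \<open>w'\<close> with \<open>d\<close> gives a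
  collapsed pair that leaves the ideal below \<open>m\<close>.\<close>

lemma cg_le_cg_if_inf_le:
  assumes m: "unique_cover m m'" and "inf w d \<le> m" "\<not> inf w' d \<le> m"
  shows "cg m m' \<subseteq> cg w w'"
  unfolding cg_le_iff[OF cg_in_Con]
  by (rule Con_unique_cover_of_not_le[OF cg_in_Con m Con_inf[OF cg_in_Con in_cg] assms(2,3)])

lemma two_meet_primes_above:
  fixes C K :: "'a::{finite,lattice} set" and m m' :: 'a
  assumes C: "full_chain C" and K: "full_chain K"
    and gen: "\<And>a. \<exists>c\<in>C. \<exists>d\<in>K. a = sup c d"
    and m: "unique_cover m m'" and "\<not> meet_prime m"
  obtains v v' w w' where "unique_cover v v'" "meet_prime v" "cg m m' \<subseteq> cg v v'"
    "unique_cover w w'" "meet_prime w" "cg m m' \<subseteq> cg w w'" "v \<noteq> w"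
proof -
  have nm: "\<not> m' \<le> m" using m by (auto simp: unique_cover_def)
  obtain c c1 where c: "c1 \<in> C" "c \<le> m" "\<not> c1 \<le> m" "\<And>e. e \<in> C \<Longrightarrow> e \<le> c \<or> c1 \<le> e"
    by (rule full_chain_cut[OF C, of "\<lambda>e. e \<le> m" m m']) (use nm in \<open>auto intro: order.trans\<close>)
  obtain d d1 where d: "d1 \<in> K" "d \<le> m" "\<not> d1 \<le> m" "\<And>e. e \<in> K \<Longrightarrow> e \<le> d \<or> d1 \<le> e"
    by (rule full_chain_cut[OF K, of "\<lambda>e. e \<le> m" m m']) (use nm in \<open>auto intro: order.trans\<close>)
  obtain a b where ab: "inf a b \<le> m" "\<not> a \<le> m" "\<not> b \<le> m"
    using \<open>\<not> meet_prime m\<close> by (auto simp: meet_prime_def)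
  have above: "c1 \<le> y \<or> d1 \<le> y" if "\<not> y \<le> m" for y
    using gen[of y] that c(2,4) d(2,4) by (metis le_supI order.trans sup_ge1 sup_ge2)
  \<comment> \<open>If \<open>a\<close> and \<open>b\<close> were both above \<open>c1\<close>, or
    both above \<open>d1\<close>, so would be \<open>inf a b \<le> m\<close>. Hence each of
    \<open>c1\<close>, \<open>d1\<close> lies below one of them.\<close>
  have le: "inf c1 d1 \<le> m"
    using above[OF ab(2)] above[OF ab(3)] ab(1) c(3) d(3)
    by (metis inf_commute inf_mono le_infI order.trans)
  have gen': "\<exists>c\<in>K. \<exists>d\<in>C. a = sup c d" for a
    using gen[of a] by (metis sup_commute)
  obtain v v' where v: "unique_cover v v'" "meet_prime v" "c1 \<le> v" "inf v d1 \<le> m" "\<not> inf v' d1 \<le> m"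
    using meet_prime_above[OF C K gen c d le] by blast
  \<comment> \<open>Exchanging the two chains gives the second element; \<open>c1\<close> lies below
    \<open>v\<close> but not below \<open>w\<close>, which separates them.\<close>
  obtain w w' where w: "unique_cover w w'" "meet_prime w" "\<not> c1 \<le> w" "inf w c1 \<le> m" "\<not> inf w' c1 \<le> m"
    using meet_prime_above[OF K C gen' d c] le by (metis inf_commute)
  show thesis
    using that[OF v(1,2) cg_le_cg_if_inf_le[OF m v(4,5)] w(1,2) cg_le_cg_if_inf_le[OF m w(4,5)]] v(3) w(3)
    by blast
qed

lemma second_cover_if_two_chains:
  fixes C K :: "'a::{finite,lattice} set"
  assumes C: "full_chain C" and K: "full_chain K"
    and gen: "\<And>a. \<exists>c\<in>C. \<exists>d\<in>K. a = sup c d"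
    and J: "J = join_irreducibles (Con :: ('a \<times> 'a) set set)"
    and x: "x \<in> J" and y: "y \<in> maximal_elements J" and xy: "x \<subset> y"
  shows "\<exists>z\<in>J. z \<noteq> y \<and> covers_in J x z"
proof -
  have yJ: "y \<in> J" and ymax: "\<And>u. u \<in> J \<Longrightarrow> \<not> y \<subset> u"
    using y by (auto simp: maximal_elements_def)
  obtain m m' where m: "unique_cover m m'" "x = cg m m'"
    using join_irreducible_Con_is_cg x J by blast
  obtain n n' where n: "unique_cover n n'" "y = cg n n'"
    using join_irreducible_Con_is_cg yJ J by blast
  have uniq: "v' = w'" if "unique_cover v v'" "unique_cover v w'" for v v' w' :: 'a
    using that by (auto simp: unique_cover_def intro: order.antisym)
  have prime_eq: "v = w \<and> cg v v' = cg w w'"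
    if "unique_cover v v'" "meet_prime v" "unique_cover w w'" "cg v v' \<subseteq> cg w w'" for v v' w w' :: 'a
    using meet_prime_cg_le_imp_eq[of v v' w w'] uniq[of v v' w'] that by auto
  \<comment> \<open>A congruence coming from a meet-prime element is maximal in \<open>J\<close>,
    but \<open>x\<close> is properly below \<open>y\<close>.\<close>
  have "\<not> meet_prime m"
    using prime_eq[OF m(1) _ n(1)] m(2) n(2) xy by auto
  then obtain v v' w w' where vw: "unique_cover v v'" "meet_prime v" "cg m m' \<subseteq> cg v v'"
    "unique_cover w w'" "meet_prime w" "cg m m' \<subseteq> cg w w'" "v \<noteq> w"
    using two_meet_primes_above[OF C K gen m(1)] by blast
  then have "cg v v' \<noteq> y \<or> cg w w' \<noteq> y"
    using prime_eq[of v v' w w'] by auto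
  then obtain u u' where u: "unique_cover u u'" "meet_prime u" "x \<subseteq> cg u u'" "cg u u' \<noteq> y"
    using vw m(2) by blast
  have uJ: "cg u u' \<in> J"
    using cg_unique_cover_join_irreducible[OF u(1)] J by simp
  have "x \<noteq> cg u u'"
    using prime_eq[OF u(1,2) n(1)] n(2) u(4) xy by auto
  \<comment> \<open>A minimal member of this set covers \<open>x\<close>. It cannot be
    \<open>y\<close>, since the maximal \<open>y\<close> would then equal
    \<open>cg u u'\<close>.\<close>
  then have "cg u u' \<in> {z \<in> J. x \<subset> z \<and> z \<subseteq> cg u u'}"
    using uJ u(3) by auto
  from finite_has_minimal2[OF finite this] obtain z where "z \<in> {z \<in> J. x \<subset> z \<and> z \<subseteq> cg u u'}"
    and "\<forall>t\<in>{z \<in> J. x \<subset> z \<and> z \<subseteq> cg u u'}. t \<subseteq> z \<longrightarrow> z = t"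
    by blast
  then have z: "z \<in> J" "x \<subset> z" "z \<subseteq> cg u u'"
    and min: "\<And>t. t \<in> J \<Longrightarrow> x \<subset> t \<Longrightarrow> t \<subseteq> cg u u' \<Longrightarrow> t \<subseteq> z \<Longrightarrow> z = t"
    by simp_all
  have "covers_in J x z"
    unfolding covers_in_def
    using x z min by (metis order.strict_implies_order order.strict_trans2 order.irrefl)
  moreover have "z \<noteq> y"
    using ymax[OF uJ] u(4) z(3) by auto
  ultimately show ?thesis using z(1) by blast
qed

section \<open>Polygonal lines\<close>

text \<open>The line through \<open>P\<close> and \<open>Q\<close> as a graph over the height
  \<open>h\<close>, prolonged beyond both ends.\<close>

definition edge_x :: "real \<times> real \<Rightarrow> real \<times> real \<Rightarrow> real \<Rightarrow> real" where
  "edge_x P Q h = fst P + (h - snd P) * ((fst Q - fst P) / (snd Q - snd P))"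

lemma edge_x_left [simp]: "edge_x P Q (snd P) = fst P"
  by (simp add: edge_x_def)

lemma edge_x_right [simp]: "snd P < snd Q \<Longrightarrow> edge_x P Q (snd Q) = fst Q"
  by (simp add: edge_x_def)

lemma continuous_on_edge_x [continuous_intros]: "continuous_on S (edge_x P Q)"
  unfolding edge_x_def by (intro continuous_intros)

lemma edge_x_in_closed_segment:
  assumes "snd P < snd Q" "snd P \<le> h" "h \<le> snd Q"
  shows "(edge_x P Q h, h) \<in> closed_segment P Q"
  unfolding closed_segment_def
proof (rule CollectI, intro exI conjI)
  define u where "u = (h - snd P) / (snd Q - snd P)"
  show "0 \<le> u" "u \<le> 1" using assms by (auto simp: u_def)
  have "u * (snd Q - snd P) = h - snd P"
    using assms(1) by (simp add: u_def)
  then have "h = (1 - u) * snd P + u * snd Q"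
    by (simp add: algebra_simps)
  moreover have "edge_x P Q h = fst P + u * (fst Q - fst P)"
    by (simp add: edge_x_def u_def)
  then have "edge_x P Q h = (1 - u) * fst P + u * fst Q"
    by (simp add: algebra_simps)
  ultimately show "(edge_x P Q h, h) = (1 - u) *\<^sub>R P + u *\<^sub>R Q"
    by (simp add: prod_eq_iff)
qed

text \<open>Above its last vertex the line continues vertically; with two or more vertices the first
  edge is prolonged downwards.\<close>

fun polyline_x :: "(real \<times> real) list \<Rightarrow> real \<Rightarrow> real" where
  "polyline_x [] h = 0"
| "polyline_x [P] h = fst P"
| "polyline_x (P # Q # Ps) h = (if h \<le> snd Q then edge_x P Q h else polyline_x (Q # Ps) h)"

abbreviation ascending :: "(real \<times> real) list \<Rightarrow> bool" where
  "ascending \<equiv> sorted_wrt (\<lambda>P Q. snd P < snd Q)"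

lemma polyline_x_hd: "ascending (P # Ps) \<Longrightarrow> polyline_x (P # Ps) (snd P) = fst P"
  by (cases Ps) auto

lemma polyline_x_tl:
  "ascending (P # Q # Ps) \<Longrightarrow> snd Q \<le> h \<Longrightarrow> polyline_x (P # Q # Ps) h = polyline_x (Q # Ps) h"
  using polyline_x_hd[of Q Ps] by (cases "h = snd Q") auto

lemma continuous_on_polyline_x: "ascending Ps \<Longrightarrow> continuous_on S (polyline_x Ps)"
proof (induction Ps rule: induct_list012)
  case (3 P Q Ps)
  have "continuous_on S (\<lambda>h. if h \<le> snd Q then edge_x P Q h else polyline_x (Q # Ps) h)"
  proof (rule continuous_on_cases_le)
    show "continuous_on {t \<in> S. t \<le> snd Q} (edge_x P Q)"
      by (rule continuous_on_edge_x)
    show "continuous_on {t \<in> S. snd Q \<le> t} (polyline_x (Q # Ps))"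
      by (rule continuous_on_subset[of S]) (use 3 in auto)
    show "continuous_on S (\<lambda>t. t)" by (rule continuous_on_id)
    show "edge_x P Q t = polyline_x (Q # Ps) t" if "t = snd Q" for t
      using that 3(3) polyline_x_hd[of Q Ps] by simp
  qed
  then show ?case by simp
qed (auto intro: continuous_on_const)

lemma polyline_x_edge:
  assumes "ascending (Ps @ P # Q # Qs)" "snd P \<le> h" "h \<le> snd Q"
  shows "polyline_x (Ps @ P # Q # Qs) h = edge_x P Q h"
  using assms
proof (induction Ps)
  case (Cons R Ps)
  obtain R' Rs where eq: "Ps @ P # Q # Qs = R' # Rs" by (cases Ps) auto
  have "R' \<in> set (Ps @ [P])" using eq by (cases Ps) auto
  then have "snd R' \<le> snd P"
    using Cons.prems(1) by (auto simp: sorted_wrt_append)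
  then have "polyline_x (R # R' # Rs) h = polyline_x (R' # Rs) h"
    using Cons.prems(1,2) eq by (intro polyline_x_tl) auto
  then show ?case
    using Cons eq by simp
qed auto

lemma polyline_x_vertex:
  assumes "ascending Ps" "P \<in> set Ps"
  shows "polyline_x Ps (snd P) = fst P"
  using assms
proof (induction Ps rule: induct_list012)
  case (3 Q R Ps)
  show ?case
  proof (cases "P = Q")
    case True
    then show ?thesis using polyline_x_hd 3(3) by simp
  next
    case False
    then have P: "P \<in> set (R # Ps)" using 3(4) by simp
    then have "snd R \<le> snd P" using 3(3) by auto
    then show ?thesis
      using polyline_x_tl[OF 3(3)] 3(2)[OF _ P] 3(3) by simp
  qed
qed auto

text \<open>The first alternative accounts for a line with a single vertex, which has no
  edge.\<close>

lemma polyline_x_on_edge: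
  assumes "ascending Ps" "Ps \<noteq> []" "snd (hd Ps) \<le> h" "h \<le> snd (last Ps)"
  shows "(polyline_x Ps h, h) \<in> set Ps \<or>
    (\<exists>Qs P Q Rs. Ps = Qs @ P # Q # Rs \<and> (polyline_x Ps h, h) \<in> closed_segment P Q)"
  using assms
proof (induction Ps rule: induct_list012)
  case (2 P)
  then show ?case by (cases P) auto
next
  case (3 P Q Ps)
  show ?case
  proof (cases "h \<le> snd Q")
    case True
    then have "(polyline_x (P # Q # Ps) h, h) \<in> closed_segment P Q"
      using 3 edge_x_in_closed_segment[of P Q h] by simp
    then show ?thesis by (metis append_Nil)
  next
    case False
    then have "polyline_x (P # Q # Ps) h = polyline_x (Q # Ps) h" by simp
    then show ?thesis
      using 3(2) 3(3-) False by simp (metis append_Cons)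
  qed
qed auto

section \<open>Maximal chains in a planar diagram\<close>

lemma le_imp_covers_rtranclp:
  fixes a b :: "'a::{finite,order}"
  assumes "a \<le> b"
  shows "(covers_in UNIV)\<^sup>*\<^sup>* a b"
  using assms
proof (induction "card {..b}" arbitrary: b rule: less_induct)
  case less
  show ?case
  proof (cases "a = b")
    case False
    then have "a \<in> {x. a \<le> x \<and> x < b}" using less.prems by auto
    from finite_has_maximal2[OF finite this] obtain k where k: "a \<le> k" "k < b"
      and max: "\<forall>x\<in>{x. a \<le> x \<and> x < b}. k \<le> x \<longrightarrow> k = x"
      by auto
    have "\<not> (\<exists>z. k < z \<and> z < b)"
    proof
      assume "\<exists>z. k < z \<and> z < b"
      then obtain z where z: "k < z" "z < b" by blast
      then have "z \<in> {x. a \<le> x \<and> x < b}" using k(1) by auto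
      then have "k = z" using max z(1) less_imp_le by blast
      then show False using z(1) by simp
    qed
    then have "covers_in UNIV k b"
      using k by (auto simp: covers_in_def)
    moreover have "{..k} \<subset> {..b}"
      using k(2) by auto
    then have "card {..k} < card {..b}"
      by (rule psubset_card_mono[rotated]) auto
    ultimately show ?thesis
      using less.hyps[of k] k(1) by auto
  qed auto
qed

lemma covers_rtranclp_imp_le: "(covers_in UNIV)\<^sup>*\<^sup>* a b \<Longrightarrow> a \<le> b"
proof (induction rule: rtranclp_induct)
  case (step y z)
  then show ?case unfolding covers_in_def by (meson less_imp_le order.trans)
qed auto

text \<open>A maximal chain listed from bottom to top, so that \<open>map p E\<close> is a polygonal
  line spanning all heights of the diagram.\<close>

definition max_path :: "'a::order list \<Rightarrow> bool" where
  "max_path E \<longleftrightarrow> E \<noteq> [] \<and> successively (covers_in UNIV) E \<and>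
     (\<forall>x. hd E \<le> x) \<and> (\<forall>x. x \<le> last E)"

lemma max_path_sorted: "max_path E \<Longrightarrow> sorted_wrt (<) E"
  unfolding max_path_def
  by (metis covers_in_def successively_mono successively_conv_sorted_wrt transp_on_less)

lemma max_path_chain:
  assumes "max_path E" "a \<in> set E" "b \<in> set E"
  shows "a \<le> b \<or> b \<le> a"
  using max_path_sorted[OF assms(1)] assms(2,3)
  by (induction E) (auto simp: less_imp_le)

lemma covers_rtranclp_imp_path:
  assumes "(covers_in UNIV)\<^sup>*\<^sup>* a b"
  shows "\<exists>E. E \<noteq> [] \<and> successively (covers_in UNIV) E \<and> hd E = a \<and> last E = b"
  using assms
proof (induction rule: converse_rtranclp_induct)
  case base
  show ?case by (rule exI[of _ "[b]"]) simp
next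
  case (step y z)
  then obtain E where E: "E \<noteq> []" "successively (covers_in UNIV) E" "hd E = z" "last E = b"
    by blast
  then have "successively (covers_in UNIV) (y # E)"
    using step(1) by (simp add: successively_Cons)
  then show ?case
    using E by (intro exI[of _ "y # E"]) simp
qed

lemma ex_bot: "\<exists>b. \<forall>x::'a::{finite,lattice}. b \<le> x"
  by (rule exI[of _ "Inf_fin UNIV"]) (simp add: Inf_fin.coboundedI)

lemma ex_top: "\<exists>t. \<forall>x::'a::{finite,lattice}. x \<le> t"
  by (rule exI[of _ "Sup_fin UNIV"]) (simp add: Sup_fin.coboundedI)

lemma ex_max_path_through_cover:
  fixes k j :: "'a::{finite,lattice}"
  assumes "covers_in UNIV k j"
  obtains E where "max_path E" "k \<in> set E" "j \<in> set E"
proof -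
  obtain b t where bt: "\<And>x::'a. b \<le> x" "\<And>x::'a. x \<le> t"
    using ex_bot ex_top by metis
  obtain E where E: "E \<noteq> []" "successively (covers_in UNIV) E" "hd E = b" "last E = k"
    using covers_rtranclp_imp_path[OF le_imp_covers_rtranclp[OF bt(1)]] by blast
  obtain F where F: "F \<noteq> []" "successively (covers_in UNIV) F" "hd F = j" "last F = t"
    using covers_rtranclp_imp_path[OF le_imp_covers_rtranclp[OF bt(2)]] by blast
  have "max_path (E @ F)"
    using E F bt assms by (simp add: max_path_def successively_append_iff)
  moreover have "k \<in> set (E @ F)" "j \<in> set (E @ F)"
    using E F by auto
  ultimately show thesis using that by blast
qed

section \<open>Sides of a maximal path in a planar diagram\<close>

locale planar_lattice =
  fixes p :: "'a::{finite,lattice} \<Rightarrow> real \<times> real"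
  assumes planar: "planar_diagram p"
begin

abbreviation ht :: "'a \<Rightarrow> real" where
  "ht a \<equiv> snd (p a)"

abbreviation path_x :: "'a list \<Rightarrow> real \<Rightarrow> real" where
  "path_x E \<equiv> polyline_x (map p E)"

definition left_of :: "'a list \<Rightarrow> 'a \<Rightarrow> bool" where
  "left_of E v \<longleftrightarrow> fst (p v) < path_x E (ht v)"

lemma ht_covers: "covers_in UNIV a b \<Longrightarrow> ht a < ht b"
  using planar by (auto simp: planar_diagram_def hasse_diagram_def)

lemma ht_mono: "a \<le> b \<Longrightarrow> ht a \<le> ht b"
proof -
  assume "a \<le> b"
  then have "(covers_in UNIV)\<^sup>*\<^sup>* a b" by (rule le_imp_covers_rtranclp)
  then show ?thesis
    by induction (auto dest: ht_covers)
qed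

lemma inj_p: "p a = p b \<longleftrightarrow> a = b"
  using planar by (auto simp: planar_diagram_def hasse_diagram_def inj_def)

lemma vertex_on_edge:
  "covers_in UNIV a b \<Longrightarrow> p c \<in> closed_segment (p a) (p b) \<Longrightarrow> c = a \<or> c = b"
  using planar by (auto simp: planar_diagram_def hasse_diagram_def)

lemma edges_meet:
  "covers_in UNIV a b \<Longrightarrow> covers_in UNIV c d \<Longrightarrow> (a, b) \<noteq> (c, d) \<Longrightarrow>
    P \<in> closed_segment (p a) (p b) \<Longrightarrow> P \<in> closed_segment (p c) (p d) \<Longrightarrow>
    P \<in> p ` ({a, b} \<inter> {c, d})"
  using planar unfolding planar_diagram_def by blast

lemma ascending_path: "max_path E \<Longrightarrow> ascending (map p E)"
proof -
  assume "max_path E"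
  then have "successively (\<lambda>a b. ht a < ht b) E"
    unfolding max_path_def by (auto elim: successively_mono ht_covers)
  then show ?thesis
    by (simp add: sorted_wrt_map successively_conv_sorted_wrt transp_def)
qed

text \<open>By the intermediate value theorem the edge meets the path above \<open>h1\<close>, hence
  above \<open>u\<close>. Planarity makes the meeting point a common vertex, which can only be
  \<open>v\<close>.\<close>

lemma edge_crosses_path_at_upper_end:
  assumes E: "max_path E" and uv: "covers_in UNIV u v"
    and h: "ht u \<le> h1" "h1 \<le> h2" "h2 \<le> ht v"
    and lt: "edge_x (p u) (p v) h1 < path_x E h1"
    and ge: "path_x E h2 \<le> edge_x (p u) (p v) h2"
  shows "v \<in> set E"
proof -
  let ?g = "\<lambda>h. edge_x (p u) (p v) h - path_x E h"
  have "continuous_on {h1..h2} ?g"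
    by (intro continuous_intros continuous_on_polyline_x ascending_path E)
  then obtain t where t: "h1 \<le> t" "t \<le> h2" "?g t = 0"
    using IVT'[of ?g h1 0 h2] lt ge h by auto
  have "t \<noteq> h1" using lt t(3) by auto
  define P where "P = (path_x E t, t)"
  have P: "P \<in> closed_segment (p u) (p v)"
    using edge_x_in_closed_segment[OF ht_covers[OF uv], of t] t h by (simp add: P_def)
  have nu: "P \<noteq> p u"
    using \<open>t \<noteq> h1\<close> t h by (auto simp: P_def dest: arg_cong[of _ _ snd])
  have ne: "E \<noteq> []" using E by (simp add: max_path_def)
  \<comment> \<open>The path runs from bottom to top, so height \<open>t\<close> is within its range
    and \<open>P\<close> lies on a genuine vertex or edge.\<close>
  have "ht (hd E) \<le> ht u" "ht v \<le> ht (last E)"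
    using E by (auto simp: max_path_def intro: ht_mono)
  then have "P \<in> set (map p E) \<or>
    (\<exists>Qs Q R Rs. map p E = Qs @ Q # R # Rs \<and> P \<in> closed_segment Q R)"
    unfolding P_def using t h ne ascending_path[OF E]
    by (intro polyline_x_on_edge) (auto simp: hd_map last_map)
  then show ?thesis
  proof (elim disjE exE conjE)
    assume "P \<in> set (map p E)"
    then show ?thesis using vertex_on_edge[OF uv] P nu by auto
  next
    fix Qs Q R Rs assume eq: "map p E = Qs @ Q # R # Rs" and seg: "P \<in> closed_segment Q R"
    then obtain xs a b zs where ab: "E = xs @ a # b # zs" "Q = p a" "R = p b"
      by (auto simp: map_eq_append_conv map_eq_Cons_conv)
    then have "covers_in UNIV a b"
      using E by (simp add: max_path_def successively_append_iff)
    then have "(a, b) = (u, v) \<or> P \<in> p ` ({u, v} \<inter> {a, b})"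
      using edges_meet[OF uv] P seg ab by blast
    then show ?thesis using ab(1) nu by auto
  qed
qed

lemma left_of_covers:
  assumes "max_path E" "covers_in UNIV u v" "left_of E u"
  shows "left_of E v \<or> v \<in> set E"
  using edge_crosses_path_at_upper_end[OF assms(1,2), of "ht u" "ht v"] assms(3) ht_covers[OF assms(2)]
  unfolding left_of_def by (cases "path_x E (ht v) \<le> fst (p v)") auto

text \<open>Climbing from \<open>u\<close> to \<open>v\<close> by covers, the left side can be left
  only through an element of \<open>E\<close> in between.\<close>

lemma left_of_above:
  assumes E: "max_path E" and "left_of E u" "u \<le> v" and "\<And>e. e \<in> set E \<Longrightarrow> u \<le> e \<Longrightarrow> \<not> e \<le> v"
  shows "left_of E v"
  using le_imp_covers_rtranclp[OF assms(3)] assms(2,4)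
proof (induction rule: rtranclp_induct)
  case (step y z)
  have yz: "y < z" using step(2) by (simp add: covers_in_def)
  have "u \<le> z"
    using covers_rtranclp_imp_le[OF step(1)] yz by auto
  moreover have "left_of E y"
    using step yz by (meson less_imp_le order.trans)
  ultimately show ?case
    using left_of_covers[OF E step(2)] step.prems(2) by blast
qed

section \<open>The leftmost maximal chain\<close>

definition slope :: "'a \<Rightarrow> 'a \<Rightarrow> real" where
  "slope a b = (fst (p b) - fst (p a)) / (ht b - ht a)"

text \<open>\<open>slope\<close> is horizontal displacement per unit of height, so its least value
  points furthest to the left.\<close>

definition leftmost_cover :: "'a \<Rightarrow> 'a \<Rightarrow> bool" where
  "leftmost_cover a b \<longleftrightarrow> covers_in UNIV a b \<and> (\<forall>b'. covers_in UNIV a b' \<longrightarrow> slope a b \<le> slope a b')"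

lemma ex_leftmost_cover:
  assumes "a < x"
  shows "\<exists>b. leftmost_cover a b"
proof -
  have "(covers_in UNIV)\<^sup>*\<^sup>* a x" "a \<noteq> x"
    using assms le_imp_covers_rtranclp[of a x] by auto
  then obtain b where "covers_in UNIV a b"
    by (auto elim: converse_rtranclpE)
  then have ne: "{b. covers_in UNIV a b} \<noteq> {}" by auto
  have "leftmost_cover a (arg_min_on (slope a) {b. covers_in UNIV a b})"
    using arg_min_if_finite(1)[OF finite ne, of "slope a"] arg_min_least[OF finite ne, of _ "slope a"]
    by (simp add: leftmost_cover_def)
  then show ?thesis by blast
qed

text \<open>If \<open>c\<close> is on \<open>E\<close>, compare the edge to \<open>b\<close> with
  the next edge of \<open>E\<close>: unless they coincide, the former starts strictly to the left,
  and it can reach the path again only at \<open>b\<close>.\<close>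

lemma leftmost_cover_weakly_left:
  assumes E: "max_path E" and c: "c \<in> set E \<or> left_of E c" and lc: "leftmost_cover c b"
  shows "b \<in> set E \<or> left_of E b"
proof (cases "left_of E c")
  case True
  then show ?thesis
    using left_of_covers[OF E] lc by (auto simp: leftmost_cover_def)
next
  case False
  have cb: "covers_in UNIV c b" using lc by (simp add: leftmost_cover_def)
  obtain xs ys where E1: "E = xs @ c # ys"
    using c False by (auto dest: split_list)
  have "ys \<noteq> []"
  proof
    assume "ys = []"
    then have "b \<le> c" using E by (simp add: E1 max_path_def)
    then show False using cb by (auto simp: covers_in_def)
  qed
  then obtain d zs where E2: "E = xs @ c # d # zs"
    using E1 by (cases ys) auto
  have cd: "covers_in UNIV c d"
    using E by (simp add: E2 max_path_def successively_append_iff)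
  show ?thesis
  proof (cases "b = d")
    case True
    then show ?thesis by (simp add: E2)
  next
    case False
    \<comment> \<open>At this height, strictly above \<open>c\<close>, both edges are still
      present.\<close>
    define h where "h = min (ht b) (ht d)"
    have h: "ht c < h" "h \<le> ht b" "h \<le> ht d"
      using ht_covers[OF cb] ht_covers[OF cd] by (auto simp: h_def)
    have on_E: "path_x E h = edge_x (p c) (p d) h"
      using polyline_x_edge[of "map p xs" "p c" "p d" "map p zs" h] ascending_path[OF E] h
      by (simp add: E2)
    have "slope c b \<le> slope c d"
      using lc cd by (simp add: leftmost_cover_def)
    then have "edge_x (p c) (p b) h \<le> edge_x (p c) (p d) h"
      using h(1) unfolding edge_x_def slope_def by (intro add_left_mono mult_left_mono) auto
    \<comment> \<open>Two different edges from \<open>c\<close> share no point above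
      \<open>c\<close>.\<close>
    moreover have "edge_x (p c) (p b) h \<noteq> edge_x (p c) (p d) h"
    proof
      assume "edge_x (p c) (p b) h = edge_x (p c) (p d) h"
      then have "(edge_x (p c) (p b) h, h) \<in> p ` ({c, b} \<inter> {c, d})"
        using edges_meet[OF cb cd] False h ht_covers[OF cb] ht_covers[OF cd]
          edge_x_in_closed_segment[of "p c" "p b" h] edge_x_in_closed_segment[of "p c" "p d" h]
        by simp
      then show False
        using False h(1) by (auto dest: arg_cong[of _ _ snd])
    qed
    ultimately have "edge_x (p c) (p b) h < path_x E h"
      using on_E by simp
    then show ?thesis
      using edge_crosses_path_at_upper_end[OF E cb, of h "ht b"] h ht_covers[OF cb]
      unfolding left_of_def by (cases "path_x E (ht b) \<le> fst (p b)") auto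
  qed
qed

lemma ex_leftmost_chain:
  obtains C where "full_chain C" "\<And>E c. max_path E \<Longrightarrow> c \<in> C \<Longrightarrow> c \<in> set E \<or> left_of E c"
proof -
  obtain b :: 'a where b: "\<And>x. b \<le> x" using ex_bot by blast
  \<comment> \<open>Leftmost covers are iterated from the bottom; \<open>f\<close> fixes the top, so
    the iteration never breaks off.\<close>
  define f where "f c = (if \<exists>x. c < x then SOME d. leftmost_cover c d else c)" for c
  have f: "leftmost_cover c (f c)" if "c < x" for c x
    using that ex_leftmost_cover[OF that] by (auto simp: f_def intro: someI_ex)
  have f_top: "f c = c" if "\<not> (\<exists>x. c < x)" for c
    using that by (simp add: f_def)
  have f_le: "c \<le> f c" for c
    using f[of c] f_top[of c] unfolding leftmost_cover_def covers_in_def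
    by (metis less_imp_le order_refl)
  define C where "C = range (\<lambda>n. (f ^^ n) b)"
  have "(f ^^ n) b \<le> (f ^^ m) b" if "n \<le> m" for n m
    using lift_Suc_mono_le[of "\<lambda>n. (f ^^ n) b"] f_le that by simp
  then have "(f ^^ n) b \<le> (f ^^ m) b \<or> (f ^^ m) b \<le> (f ^^ n) b" for n m
    by (cases "n \<le> m") auto
  then have "x \<le> y \<or> y \<le> x" if "x \<in> C" "y \<in> C" for x y
    using that unfolding C_def by blast
  moreover have "b \<in> C"
    unfolding C_def by (rule range_eqI[of _ _ 0]) simp
  moreover have fC: "f c \<in> C" if "c \<in> C" for c
    using that unfolding C_def by (auto intro: range_eqI[of _ _ "Suc _"])
  ultimately have "full_chain C"
    using b f unfolding full_chain_def leftmost_cover_def by blast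
  moreover have "c \<in> set E \<or> left_of E c" if E: "max_path E" and "c \<in> C" for E c
  proof -
    obtain n where "c = (f ^^ n) b" using \<open>c \<in> C\<close> by (auto simp: C_def)
    moreover have "(f ^^ n) b \<in> set E \<or> left_of E ((f ^^ n) b)"
    proof (induction n)
      case 0
      have "hd E = b" using E b by (auto simp: max_path_def intro: order.antisym)
      then show ?case using E by (auto simp: max_path_def)
    next
      case (Suc n)
      then show ?case
        using leftmost_cover_weakly_left[OF E Suc f[of "(f ^^ n) b"]] f_top[of "(f ^^ n) b"] by fastforce
    qed
    ultimately show ?thesis by simp
  qed
  ultimately show thesis using that by blast
qed

end

section \<open>Reflection, exchanging left and right\<close>

definition mirror :: "('a \<Rightarrow> real \<times> real) \<Rightarrow> 'a \<Rightarrow> real \<times> real" where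
  "mirror p a = (- fst (p a), snd (p a))"

lemma edge_x_mirror: "edge_x (mirror p a) (mirror p b) h = - edge_x (p a) (p b) h"
  by (simp add: edge_x_def mirror_def field_simps minus_divide_left diff_divide_distrib)

lemma polyline_x_mirror: "polyline_x (map (mirror p) E) h = - polyline_x (map p E) h"
  by (induction E rule: induct_list012) (auto simp: edge_x_mirror, auto simp: mirror_def)

context planar_lattice
begin

text \<open>The reflection is linear and injective, so it preserves segments and their
  intersections. The right boundary chain is the leftmost one of the reflected diagram.\<close>

lemma planar_lattice_mirror: "planar_lattice (mirror p)"
proof
  define r where "r = (\<lambda>P::real \<times> real. (- fst P, snd P))"
  have r: "linear r" "inj r"
    unfolding r_def by (auto intro!: linearI simp: inj_def prod_eq_iff)
  have m: "mirror p a = r (p a)" for a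
    by (simp add: mirror_def r_def)
  have im: "mirror p ` A = r ` p ` A" for A
    by (auto simp: m)
  have seg: "closed_segment (mirror p a) (mirror p b) = r ` closed_segment (p a) (p b)" for a b
    unfolding m by (rule closed_segment_linear_image[OF r(1)])
  have [simp]: "snd (mirror p a) = snd (p a)" for a
    by (simp add: mirror_def)
  have "inj (mirror p)"
    using inj_p inj_eq[OF r(2)] by (auto simp: inj_def m)
  moreover have "c = a \<or> c = b"
    if "covers_in UNIV a b" "mirror p c \<in> closed_segment (mirror p a) (mirror p b)" for a b c
  proof -
    have "r (p c) \<in> r ` closed_segment (p a) (p b)"
      using that(2) unfolding seg by (simp add: m)
    then show ?thesis
      using vertex_on_edge[OF that(1)] inj_image_mem_iff[OF r(2)] by blast
  qed
  moreover have "closed_segment (mirror p a) (mirror p b) \<inter> closed_segment (mirror p c) (mirror p d)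
      \<subseteq> mirror p ` ({a, b} \<inter> {c, d})"
    if "covers_in UNIV a b" "covers_in UNIV c d" "(a, b) \<noteq> (c, d)" for a b c d
    unfolding seg im image_Int[OF r(2), symmetric]
    by (rule image_mono) (use edges_meet[OF that] in blast)
  ultimately show "planar_diagram (mirror p)"
    unfolding planar_diagram_def hasse_diagram_def using ht_covers by simp
qed

lemma left_of_mirror:
  "planar_lattice.left_of (mirror p) E v \<longleftrightarrow> path_x E (ht v) < fst (p v)"
  unfolding planar_lattice.left_of_def[OF planar_lattice_mirror] polyline_x_mirror
  by (simp add: mirror_def)

end

section \<open>Slim planar semimodular lattices are generated by two maximal chains\<close>

lemma semimodularD:
  fixes a b c :: "'a::lattice"
  assumes "semimodular TYPE('a)" "covers_in UNIV a b" "\<not> b \<le> sup a c"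
  shows "covers_in UNIV (sup a c) (sup b c)"
  using assms unfolding semimodular_def by (metis sup_ge1)

lemma covers_sup:
  fixes a b k :: "'a::lattice"
  assumes sm: "semimodular TYPE('a)" and "covers_in UNIV k a" "covers_in UNIV k b" "\<not> b \<le> a"
  shows "covers_in UNIV a (sup a b)"
proof -
  have "sup k a = a"
    using assms(2) by (auto simp: covers_in_def intro: sup.absorb2)
  then show ?thesis
    using semimodularD[OF sm assms(3), of a] assms(4) by (simp add: sup_commute)
qed

lemma inf_covers:
  fixes a b k :: "'a::lattice"
  assumes "covers_in UNIV k a" "covers_in UNIV k b" "a \<noteq> b"
  shows "inf a b = k"
proof (rule ccontr)
  assume "inf a b \<noteq> k"
  moreover have "k \<le> inf a b"
    using assms by (auto simp: covers_in_def)
  ultimately have "inf a b = a" "inf a b = b"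
    using assms(1,2) unfolding covers_in_def
    by (metis UNIV_I inf_le1 inf_le2 order.order_iff_strict)+
  then show False using assms(3) by simp
qed

text \<open>Semimodularity makes \<open>sup a c\<close> a cover of \<open>a\<close> and of
  \<open>c\<close>. With \<open>b\<close> below it, all pairwise joins equal it and all pairwise
  meets equal \<open>k\<close>, which is an \<open>M_3\<close>.\<close>

lemma sup_three_covers_distinct:
  fixes a b c k :: "'a::lattice"
  assumes slim: "slim TYPE('a)" and sm: "semimodular TYPE('a)"
    and k: "covers_in UNIV k a" "covers_in UNIV k b" "covers_in UNIV k c"
    and ne: "a \<noteq> b" "a \<noteq> c" "b \<noteq> c"
  shows "\<not> b \<le> sup a c"
proof
  assume le: "b \<le> sup a c"
  define s where "s = sup a c"
  have lt: "k < a" "k < b" "k < c" using k by (auto simp: covers_in_def)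
  have incomp: "\<not> y \<le> x" if "covers_in UNIV k x" "covers_in UNIV k y" "x \<noteq> y" for x y
    using that unfolding covers_in_def by (metis UNIV_I order.not_eq_order_implies_strict)
  have "covers_in UNIV a s" "covers_in UNIV c s"
    using covers_sup[OF sm k(1,3)] covers_sup[OF sm k(3,1)] incomp[OF k(1,3)] incomp[OF k(3,1)] ne
    by (auto simp: s_def sup_commute)
  then have cov: "x = s" if "a < x \<or> c < x" "x \<le> s" for x
    using that unfolding covers_in_def by (metis UNIV_I order.not_eq_order_implies_strict)
  have "a < sup a b" "c < sup b c"
    using incomp[OF k(1,2)] incomp[OF k(3,2)] ne
    by (metis order.not_eq_order_implies_strict sup_ge1 sup_ge2)+
  then have sups: "sup a b = s" "sup b c = s"
    using cov[of "sup a b"] cov[of "sup b c"] le by (auto simp: s_def)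
  have infs: "inf a b = k" "inf a c = k" "inf b c = k"
    using inf_covers k ne by blast+
  have "b \<noteq> s"
    using incomp[OF k(2,1)] ne(1) by (auto simp: s_def)
  moreover have "a \<noteq> s" "c \<noteq> s"
    using \<open>covers_in UNIV a s\<close> \<open>covers_in UNIV c s\<close> by (auto simp: covers_in_def)
  ultimately have "distinct [k, a, b, c, s]"
    using lt ne le by (auto simp: s_def)
  then show False
    using slim infs sups s_def unfolding slim_def by metis
qed

lemma full_chain_greatest_below:
  fixes C :: "'a::{finite,order} set"
  assumes C: "full_chain C"
  obtains c where "c \<in> C" "c \<le> j" "\<And>e. e \<in> C \<Longrightarrow> e \<le> j \<Longrightarrow> e \<le> c"
proof -
  obtain b where "b \<in> {c \<in> C. c \<le> j}" using C by (auto simp: full_chain_def)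
  from finite_has_maximal2[OF finite this] obtain c where "c \<in> {c \<in> C. c \<le> j}"
    "\<forall>e\<in>{c \<in> C. c \<le> j}. c \<le> e \<longrightarrow> c = e" by blast
  then show thesis
    using that[of c] C unfolding full_chain_def by blast
qed

text \<open>In a counterexample \<open>j\<close> choose \<open>k\<close> covered by \<open>j\<close> and above the greatest elements \<open>c\<close>, \<open>d\<close> of
  the two boundary chains below \<open>j\<close>. Joining \<open>k\<close> with the next elements of these chains gives one
  cover of \<open>k\<close> on either side of \<open>j\<close>. The join of these two covers lies on every maximal chain
  through \<open>k\<close> and \<open>j\<close>, hence above \<open>j\<close>, and so the three covers generate an \<open>M\<^sub>3\<close>.\<close>

lemma (in planar_lattice) two_generating_chains:
  assumes sm: "semimodular TYPE('a)" and slim: "slim TYPE('a)"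
  obtains C K :: "'a set" where "full_chain C" "full_chain K" "\<And>j. \<exists>c\<in>C. \<exists>d\<in>K. j = sup c d"
proof -
  interpret m: planar_lattice "mirror p" by (rule planar_lattice_mirror)
  obtain C where C: "full_chain C" and Cl: "\<And>E c. max_path E \<Longrightarrow> c \<in> C \<Longrightarrow> c \<in> set E \<or> left_of E c"
    using ex_leftmost_chain by blast
  obtain K where K: "full_chain K" and Kr: "\<And>E c. max_path E \<Longrightarrow> c \<in> K \<Longrightarrow> c \<in> set E \<or> m.left_of E c"
    using m.ex_leftmost_chain by blast
  have "\<exists>c\<in>C. \<exists>d\<in>K. j = sup c d" for j
  proof (rule ccontr)
    assume neg: "\<not> ?thesis"
    obtain c where c: "c \<in> C" "c \<le> j" "\<And>e. e \<in> C \<Longrightarrow> e \<le> j \<Longrightarrow> e \<le> c"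
      using full_chain_greatest_below[OF C] by blast
    obtain d where d: "d \<in> K" "d \<le> j" "\<And>e. e \<in> K \<Longrightarrow> e \<le> j \<Longrightarrow> e \<le> d"
      using full_chain_greatest_below[OF K] by blast
    have "(covers_in UNIV)\<^sup>*\<^sup>* (sup c d) j" "sup c d \<noteq> j"
      using neg c(1,2) d(1,2) by (auto intro!: le_imp_covers_rtranclp)
    then obtain k where kj: "covers_in UNIV k j" and "(covers_in UNIV)\<^sup>*\<^sup>* (sup c d) k"
      by (auto elim: rtranclp.cases)
    from covers_rtranclp_imp_le[OF this(2)] have k: "c \<le> k" "d \<le> k" by auto
    have "k < j" using kj by (simp add: covers_in_def)
    obtain E where E: "max_path E" "k \<in> set E" "j \<in> set E"
      using ex_max_path_through_cover[OF kj] by blast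
    \<comment> \<open>\<open>E\<close> contains both ends of the covering pair \<open>k\<close>,
      \<open>j\<close>, so nothing on it lies in between.\<close>
    have cut: "e \<le> k \<or> j \<le> e" if "e \<in> set E" for e
      using max_path_chain[OF E(1) that E(2)] max_path_chain[OF E(1) that E(3)] kj
      unfolding covers_in_def by (metis UNIV_I order.order_iff_strict)
    \<comment> \<open>Since no element of \<open>E\<close> lies between \<open>e'\<close> and
      \<open>sup k e'\<close>, the side of \<open>E\<close> on which \<open>e'\<close> lies is
      inherited by this cover of \<open>k\<close>.\<close>
    have side: "covers_in UNIV k (sup k e') \<and> sup k e' \<noteq> j \<and> e' \<notin> set E \<and>
        (\<forall>a\<in>set E. e' \<le> a \<longrightarrow> \<not> a \<le> sup k e')"
      if ee: "covers_in UNIV e e'" and "e \<le> k" "\<not> e' \<le> j" for e e'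
    proof -
      have ne'k: "\<not> e' \<le> k" using that(3) \<open>k < j\<close> by auto
      have cov: "covers_in UNIV k (sup k e')"
        using semimodularD[OF sm ee, of k] ne'k \<open>e \<le> k\<close> by (simp add: sup.absorb2 sup_commute)
      moreover have ne: "sup k e' \<noteq> j"
        using that(3) by auto
      moreover have "e' \<notin> set E"
        using cut[of e'] ne'k ee \<open>e \<le> k\<close> \<open>k < j\<close> that(3) unfolding covers_in_def
        by (metis UNIV_I order.order_iff_strict order.strict_trans1)
      moreover have "\<not> j \<le> sup k e'"
        using cov kj ne unfolding covers_in_def
        by (metis UNIV_I order.not_eq_order_implies_strict)
      then have "\<forall>a\<in>set E. e' \<le> a \<longrightarrow> \<not> a \<le> sup k e'"
        using cut ne'k by (meson order.trans)
      ultimately show ?thesis by blast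
    qed
    obtain c' where c': "c' \<in> C" "covers_in UNIV c c'"
      using C c(1) k(1) \<open>k < j\<close> unfolding full_chain_def by (meson order.strict_trans1)
    have "\<not> c' \<le> j" using c(3)[OF c'(1)] c'(2) by (auto simp: covers_in_def)
    note sc = side[OF c'(2) k(1) this]
    obtain d' where d': "d' \<in> K" "covers_in UNIV d d'"
      using K d(1) k(2) \<open>k < j\<close> unfolding full_chain_def by (meson order.strict_trans1)
    have "\<not> d' \<le> j" using d(3)[OF d'(1)] d'(2) by (auto simp: covers_in_def)
    note sd = side[OF d'(2) k(2) this]
    define k1 where "k1 = sup k c'"
    define k2 where "k2 = sup k d'"
    have l1: "left_of E k1"
      unfolding k1_def by (rule left_of_above[OF E(1), of c']) (use Cl[OF E(1) c'(1)] sc in auto)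
    have l2: "m.left_of E k2"
      unfolding k2_def by (rule m.left_of_above[OF E(1), of d']) (use Kr[OF E(1) d'(1)] sd in auto)
    have not_both: "\<not> (left_of E v \<and> m.left_of E v)" for v
      by (auto simp: left_of_mirror left_of_def)
    have ne: "k1 \<noteq> k2" using l1 l2 not_both by auto
    have covs: "covers_in UNIV k k1" "covers_in UNIV k k2" "k1 \<noteq> j" "k2 \<noteq> j"
      using sc sd by (auto simp: k1_def k2_def)
    then have lt: "k < k1" "k < k2" by (auto simp: covers_in_def)
    have incomp: "\<not> k1 \<le> k2" "\<not> k2 \<le> k1"
      using covs ne unfolding covers_in_def by (metis UNIV_I order.not_eq_order_implies_strict)+
    define s where "s = sup k1 k2"
    have "covers_in UNIV k1 s" "covers_in UNIV k2 s"
      using covers_sup[OF sm covs(1,2)] covers_sup[OF sm covs(2,1)] incomp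
      by (auto simp: s_def sup_commute)
    \<comment> \<open>Off the path, \<open>s\<close> would be on the left as a cover of
      \<open>k1\<close> and on the right as a cover of \<open>k2\<close>.\<close>
    then have "s \<in> set E"
      using left_of_covers[OF E(1) _ l1] m.left_of_covers[OF E(1) _ l2] not_both by blast
    moreover have "\<not> s \<le> k"
      using lt by (auto simp: s_def)
    ultimately have "j \<le> sup k1 k2"
      unfolding s_def using cut by blast
    then show False
      using sup_three_covers_distinct[OF slim sm covs(1) kj covs(2)] covs ne by auto
  qed
  then show thesis using that C K by blast
qed

theorem corollary3p5:
  fixes D J :: "('a::{finite,lattice} \<times> 'a) set set"
    and x y :: "('a \<times> 'a) set"
  assumes "planar TYPE('a)" and "semimodular TYPE('a)" and "slim TYPE('a)"
    and "D = Con" and "J = join_irreducibles D"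
    and "x \<in> J" and "y \<in> maximal_elements J" and "covers_in J x y"
  shows "\<exists>z\<in>J. z \<noteq> y \<and> covers_in J x z"
proof -
  obtain p :: "'a \<Rightarrow> real \<times> real" where "planar_diagram p"
    using assms(1) by (auto simp: planar_def)
  then interpret planar_lattice p by unfold_locales
  obtain C K :: "'a set" where "full_chain C" "full_chain K" "\<And>j. \<exists>c\<in>C. \<exists>d\<in>K. j = sup c d"
    using two_generating_chains[OF assms(2,3)] by blast
  then show ?thesis
    using second_cover_if_two_chains[of C K J x y] assms(4-8) by (simp add: covers_in_def)
qed

end
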